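(* Let $A\in\mathbb{R}^{m\times n}$ have full row rank, let $b\in\mathbb{R}^m$, and suppose $\{x\in\mathbb{R}^n_+ : Ax=b\}\neq\emptyset$. Let $\mathcal{P}_{A,b}=\{y\in\mathbb{R}^n : A(y\circ y)=b\}$. For any $y\in\mathcal{P}_{A,b}$ with regular representation $(M,N,r)$, the inner and contingent tangent cones of $\mathcal{P}_{A,b}$ at $y$ are given by $$\mathcal{T}^i_{\mathcal{P}_{A,b}}(y)=\mathcal{T}_{\mathcal{P}_{A,b}}(y)=\{h\in\mathbb{R}^n : MA(y\circ h)=0,\ NA(h\circ h)=0\}.$$
   Context: $\circ$ denotes the entrywise (Hadamard) product and $D_y=\mathrm{Diag}(y)$ the diagonal matrix with diagonal $y$. Regular representation: for $y\in\mathcal{P}_{A,b}$, a triple $(M,N,r)$ is a regular representation of $y$ if $r=\mathrm{rank}(AD_y)$, $M\in\mathbb{R}^{r\times m}$ has rows forming a basis of $\mathrm{Range}[AD_y]\subset\mathbb{R}^m$, and $N\in\mathbb{R}^{(m-r)\times m}$ has rows forming a basis of the orthogonal complement of $\mathrm{Range}[AD_y]$ in $\mathbb{R}^m$ (so $[M;N]\in\mathbb{R}^{m\times m}$, obtained by stacking, is invertible and $MN^\top=0$; $M$ or $N$ may have no rows). It then holds that $MAD_y$ has full row rank, $NAD_y=0$ and $Nb=0$. Tangent cones: for a closed set $S\subset\mathbb{R}^n$ and $x\in S$, the inner tangent cone is $\mathcal{T}^i_S(x)=\{h\in\mathbb{R}^n : \mathrm{dist}(x+th,S)=o(t),\ t\ge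 0\}$ (as $t\downarrow 0$), and the contingent tangent cone is $\mathcal{T}_S(x)=\{h\in\mathbb{R}^n : \exists\, t_k\downarrow 0,\ \mathrm{dist}(x+t_kh,S)=o(t_k)\}$. *)

theory Defs
  imports "HOL-Analysis.Analysis" "HOL-Library.Landau_Symbols"
begin

text \<open>On \<open>real ^ 'n\<close> the library's multiplication is the entrywise (Hadamard) product.\<close>

definition diag_matrix :: "real ^ 'n \<Rightarrow> real ^ 'n ^ 'n" where
  "diag_matrix y = (\<chi> i j. if i = j then y $ i else 0)"

definition squared_feasible :: "real ^ 'n ^ 'm \<Rightarrow> real ^ 'm \<Rightarrow> (real ^ 'n) set" where
  "squared_feasible A b = {y. A *v (y * y) = b}"

text \<open>The row numbers of the two matrices of a regular representation depend on a rank and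
  may be zero, so they cannot be cardinalities of index types. A matrix with
  \<open>k\<close> rows in \<open>real ^ 'm\<close> is encoded as the list of its rows, of length \<open>k\<close>,
  and its product with a vector is the list of entries of the result.\<close>

definition rows_mult :: "(real ^ 'm) list \<Rightarrow> real ^ 'm \<Rightarrow> real list" where
  "rows_mult R v = map (\<lambda>u. u \<bullet> v) R"

definition rows_form_basis :: "(real ^ 'm) list \<Rightarrow> (real ^ 'm) set \<Rightarrow> bool" where
  "rows_form_basis R V \<longleftrightarrow> distinct R \<and> independent (set R) \<and> span (set R) = V"

definition regular_representation ::
    "real ^ 'n ^ 'm \<Rightarrow> real ^ 'n \<Rightarrow> (real ^ 'm) list \<Rightarrow> (real ^ 'm) list \<Rightarrow> nat \<Rightarrow> bool" where
  "regular_representation A y M N r \<longleftrightarrow>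
     (let B = A ** diag_matrix y; V = range ((*v) B) in
        r = rank B \<and>
        length M = r \<and> rows_form_basis M V \<and>
        length N = CARD('m) - r \<and> rows_form_basis N (orthogonal_comp V))"

text \<open>The tangent cones are meant for closed \<open>S\<close> and \<open>x \<in> S\<close>; note that \<open>infdist x {} = 0\<close>.\<close>

definition inner_tangent_cone :: "'a::real_normed_vector set \<Rightarrow> 'a \<Rightarrow> 'a set" where
  "inner_tangent_cone S x =
     {h. (\<lambda>t::real. infdist (x + t *\<^sub>R h) S) \<in> o[at_right 0](\<lambda>t. t)}"

definition contingent_tangent_cone :: "'a::real_normed_vector set \<Rightarrow> 'a \<Rightarrow> 'a set" where
  "contingent_tangent_cone S x =
     {h. \<exists>t :: nat \<Rightarrow> real. (\<forall>k. 0 < t k) \<and> t \<longlonglongrightarrow> 0 \<and>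
           (\<lambda>k. infdist (x + t k *\<^sub>R h) S) \<in> o(t)}"

end

(* The square of a curve in the set is prescribed coordinatewise.  If A(y o h) = 0 and
   A(h o h) = A(y o v), then A maps (y + t h) o (y + t h) - t^2 (y o v) to A(y o y) for
   every t.  For small t > 0 this vector is nonnegative, because it tends to y o y and equals
   t^2 (h o h) on the zeros of y, and its square root with the signs of y + t h stays within
   O(t^2) of y + t h.  Conversely, a point y + t d of the set satisfies
   2 A(y o d) + t A(d o d) = 0; as d tends to h and t to 0, this yields A(y o h) = 0 and, the
   range of A Diag(y) being closed, also A(h o h) in that range. *)

theory Submission
  imports Defs
begin

section \<open>Tangent cones\<close>

lemma inner_subset_contingent_tangent_cone:
  "inner_tangent_cone S x \<subseteq> contingent_tangent_cone S x"
proof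
  fix h assume "h \<in> inner_tangent_cone S x"
  then have h: "(\<lambda>t::real. infdist (x + t *\<^sub>R h) S) \<in> o[at_right 0](\<lambda>t. t)"
    by (simp add: inner_tangent_cone_def)
  \<comment> \<open>\<open>Suc\<close> matters: the contingent cone asks for a positive step at
    every index, including k = 0.\<close>
  define t where "t k = inverse (real (Suc k))" for k
  have t: "0 < t k" for k
    by (simp add: t_def)
  have lim: "t \<longlonglongrightarrow> 0"
    unfolding t_def by (rule LIMSEQ_inverse_real_of_nat)
  then have "filterlim t (at_right 0) sequentially"
    using t by (auto simp: filterlim_at less_imp_neq[symmetric] intro!: always_eventually)
  from landau_o.small.compose[OF h this] t lim
  show "h \<in> contingent_tangent_cone S x"
    unfolding contingent_tangent_cone_def by auto
qed

text \<open>A closed nonempty set in a Euclidean space has a nearest point p_k to x + t_k h. The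
  quotient d_k = (p_k - x) / t_k then differs from h by exactly the distance divided by t_k, which
  tends to 0. This trades the distance condition for exact membership, so that the equations of the
  set can be used.\<close>

lemma contingent_tangent_cone_sequence:
  fixes S :: "'a::euclidean_space set"
  assumes "closed S" "S \<noteq> {}" "h \<in> contingent_tangent_cone S x"
  obtains t d where "\<And>k. 0 < t k" "t \<longlonglongrightarrow> (0::real)" "d \<longlonglongrightarrow> h" "\<And>k::nat. x + t k *\<^sub>R d k \<in> S"
proof -
  from assms(3) obtain t :: "nat \<Rightarrow> real" where t: "\<And>k. 0 < t k" and lim: "t \<longlonglongrightarrow> 0"
    and small: "(\<lambda>k. infdist (x + t k *\<^sub>R h) S) \<in> o(t)"
    unfolding contingent_tangent_cone_def by blast
  have "\<exists>p\<in>S. infdist (x + t k *\<^sub>R h) S = dist (x + t k *\<^sub>R h) p" for k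
    using infdist_attains_inf[OF assms(1,2)] by metis
  then obtain p where p: "\<And>k. p k \<in> S"
    and inf: "\<And>k. infdist (x + t k *\<^sub>R h) S = dist (x + t k *\<^sub>R h) (p k)"
    by metis
  define d where "d k = (p k - x) /\<^sub>R t k" for k
  have mem: "x + t k *\<^sub>R d k \<in> S" for k
    using p[of k] t[of k] by (simp add: d_def)
  have ratio: "infdist (x + t k *\<^sub>R h) S / t k = dist (d k) h" for k
  proof -
    have "p k = x + t k *\<^sub>R d k"
      using t[of k] by (simp add: d_def)
    then have "infdist (x + t k *\<^sub>R h) S = norm (t k *\<^sub>R (h - d k))"
      by (simp add: inf dist_norm algebra_simps)
    then show ?thesis
      using t[of k] by (simp add: dist_norm norm_minus_commute)
  qed
  have "d \<longlonglongrightarrow> h"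
    using smalloD_tendsto[OF small] unfolding ratio tendsto_dist_iff[symmetric] .
  from that[OF t lim this mem] show ?thesis .
qed

text \<open>A second-order correction is enough, since t^2 = o(t).\<close>

lemma inner_tangent_coneI:
  assumes "\<forall>\<^sub>F t in at_right 0. \<exists>z\<in>S. norm (x + t *\<^sub>R h - z) \<le> C * t\<^sup>2"
  shows "h \<in> inner_tangent_cone S x"
proof -
  have "(\<lambda>t. infdist (x + t *\<^sub>R h) S) \<in> O[at_right 0](\<lambda>t. t\<^sup>2)"
  proof (rule bigoI)
    show "\<forall>\<^sub>F t in at_right 0. norm (infdist (x + t *\<^sub>R h) S) \<le> C * norm (t\<^sup>2)"
      using assms
    proof eventually_elim
      case (elim t)
      then obtain z where "z \<in> S" "dist (x + t *\<^sub>R h) z \<le> C * t\<^sup>2"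
        by (auto simp: dist_norm)
      then show ?case
        using infdist_le2 by (simp add: infdist_nonneg)
    qed
  qed
  also have "(\<lambda>t::real. t\<^sup>2) \<in> o[at_right 0](\<lambda>t. t)"
  proof (rule smalloI_tendsto)
    have "((\<lambda>t::real. t) \<longlongrightarrow> 0) (at_right 0)"
      by (rule tendsto_ident_at)
    then show "((\<lambda>t::real. t\<^sup>2 / t) \<longlongrightarrow> 0) (at_right 0)"
      by (simp add: power2_eq_square)
    show "\<forall>\<^sub>F t::real in at_right 0. t \<noteq> 0"
      by (simp add: eventually_at_filter)
  qed
  finally show ?thesis
    by (simp add: inner_tangent_cone_def)
qed

section \<open>Matrices given by lists of rows\<close>

lemma rows_mult_eq_0_iff:
  assumes "length R = k"
  shows "rows_mult R v = replicate k 0 \<longleftrightarrow> (\<forall>u\<in>set R. u \<bullet> v = 0)"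
proof -
  have "replicate k 0 = map (\<lambda>_. 0::real) R"
    by (simp add: assms map_replicate_const)
  then show ?thesis
    by (simp add: rows_mult_def)
qed

text \<open>Orthogonality to a spanning family extends to its span by linearity.\<close>

lemma rows_mult_basis_eq_0_iff:
  assumes "rows_form_basis R V" "length R = k"
  shows "rows_mult R v = replicate k 0 \<longleftrightarrow> v \<in> orthogonal_comp V"
proof -
  have "(\<forall>u\<in>set R. u \<bullet> v = 0) \<longleftrightarrow> (\<forall>u\<in>span (set R). orthogonal v u)"
    using orthogonal_to_span[of _ "set R" v] span_base[of _ "set R"]
    by (auto simp: orthogonal_def inner_commute)
  then show ?thesis
    using assms(1) unfolding rows_mult_eq_0_iff[OF assms(2)] rows_form_basis_def orthogonal_comp_def
    by (auto simp: orthogonal_commute)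
qed

lemma matrix_diag_mult_vec:
  "(A ** diag_matrix y) *v h = A *v (y * h)"
proof -
  have "diag_matrix y *v h = y * h"
    by (simp add: vec_eq_iff diag_matrix_def matrix_vector_mult_def if_distrib[of "\<lambda>x. x * _"]
        cong: if_cong)
  then show ?thesis
    by (simp flip: matrix_vector_mul_assoc)
qed

text \<open>This removes the chosen bases. With V the range of A Diag(y), the rows of M annihilate
  exactly the complement of V, which meets V only in 0, and A(y o h) lies in V. The rows of N
  annihilate exactly the double complement of V, which is V itself because V is a subspace.\<close>

lemma regular_representation_kernels:
  fixes A :: "real ^ 'n ^ 'm"
  assumes "regular_representation A y M N r"
  shows "rows_mult M (A *v (y * h)) = replicate r 0 \<longleftrightarrow> A *v (y * h) = 0"
    and "rows_mult N w = replicate (CARD('m) - r) 0 \<longleftrightarrow> w \<in> range (\<lambda>v. A *v (y * v))"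
proof -
  define V where "V = range (\<lambda>v. A *v (y * v))"
  have V: "V = range ((*v) (A ** diag_matrix y))"
    by (simp add: V_def matrix_diag_mult_vec)
  have sub: "subspace V"
    unfolding V by (intro linear_subspace_image matrix_vector_mul_linear subspace_UNIV)
  from assms have M: "rows_form_basis M V" "length M = r"
    and N: "rows_form_basis N (orthogonal_comp V)" "length N = CARD('m) - r"
    by (auto simp: regular_representation_def Let_def V)
  have "w \<in> orthogonal_comp V \<longleftrightarrow> w = 0" if "w \<in> V" for w
    using that by (auto simp: orthogonal_comp_def orthogonal_def)
  then show "rows_mult M (A *v (y * h)) = replicate r 0 \<longleftrightarrow> A *v (y * h) = 0"
    unfolding rows_mult_basis_eq_0_iff[OF M] by (simp add: V_def)
  show "rows_mult N w = replicate (CARD('m) - r) 0 \<longleftrightarrow> w \<in> range (\<lambda>v. A *v (y * v))"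
    unfolding rows_mult_basis_eq_0_iff[OF N] orthogonal_comp_self[OF sub] by (simp add: V_def)
qed

section \<open>Tangents of the squared feasible set\<close>

lemma tendsto_mult_vec [tendsto_intros]:
  fixes f g :: "'a \<Rightarrow> real ^ 'n"
  assumes "(f \<longlongrightarrow> a) F" "(g \<longlongrightarrow> b) F"
  shows "((\<lambda>x. f x * g x) \<longlongrightarrow> a * b) F"
  by (rule vec_tendstoI) (auto intro!: tendsto_intros assms)

lemma tendsto_matrix_vector_mult [tendsto_intros]:
  fixes A :: "real ^ 'n ^ 'm"
  assumes "(f \<longlongrightarrow> a) F"
  shows "((\<lambda>x. A *v f x) \<longlongrightarrow> A *v a) F"
  by (rule bounded_linear.tendsto[OF _ assms]) (simp add: linear_conv_bounded_linear[symmetric])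

lemma closed_squared_feasible: "closed (squared_feasible A b)"
  unfolding squared_feasible_def
  by (intro closed_Collect_eq) (auto simp: continuous_on_def intro!: tendsto_intros)

text \<open>The square expands into y o y plus t times a remainder; A(y o y) = b cancels, and the
  nonzero factor t can be divided out.\<close>

lemma squared_feasible_add_iff:
  assumes "y \<in> squared_feasible A b" "t \<noteq> 0"
  shows "y + t *\<^sub>R d \<in> squared_feasible A b \<longleftrightarrow> 2 *\<^sub>R (A *v (y * d)) + t *\<^sub>R (A *v (d * d)) = 0"
proof -
  have "(y + t *\<^sub>R d) * (y + t *\<^sub>R d) = y * y + t *\<^sub>R (2 *\<^sub>R (y * d) + t *\<^sub>R (d * d))"
    by (simp add: vec_eq_iff algebra_simps)
  then have "A *v ((y + t *\<^sub>R d) * (y + t *\<^sub>R d)) =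
      A *v (y * y) + t *\<^sub>R (2 *\<^sub>R (A *v (y * d)) + t *\<^sub>R (A *v (d * d)))"
    by (simp only: matrix_vector_right_distrib matrix_vector_mult_scaleR)
  with assms show ?thesis
    by (simp add: squared_feasible_def)
qed

lemma contingent_tangent_squared_feasible:
  fixes A :: "real ^ 'n ^ 'm"
  assumes y: "y \<in> squared_feasible A b"
    and h: "h \<in> contingent_tangent_cone (squared_feasible A b) y"
  shows "A *v (y * h) = 0" "A *v (h * h) \<in> range (\<lambda>v. A *v (y * v))"
proof -
  obtain t d where t: "\<And>k::nat. 0 < t k" "t \<longlonglongrightarrow> 0" and d: "d \<longlonglongrightarrow> h"
    and mem: "\<And>k. y + t k *\<^sub>R d k \<in> squared_feasible A b"
    using contingent_tangent_cone_sequence[OF closed_squared_feasible _ h] y by blast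
  have eq: "2 *\<^sub>R (A *v (y * d k)) + t k *\<^sub>R (A *v (d k * d k)) = 0" for k
    using mem[of k] squared_feasible_add_iff[OF y] t(1)[of k] by simp
  \<comment> \<open>The factor \<open>t k\<close> suppresses the quadratic term in the limit,
    leaving only the first-order condition.\<close>
  have "(\<lambda>k. 2 *\<^sub>R (A *v (y * d k)) + t k *\<^sub>R (A *v (d k * d k)))
      \<longlonglongrightarrow> 2 *\<^sub>R (A *v (y * h)) + 0 *\<^sub>R (A *v (h * h))"
    by (intro tendsto_intros t d)
  then have "2 *\<^sub>R (A *v (y * h)) + 0 *\<^sub>R (A *v (h * h)) = 0"
    unfolding eq by (simp add: LIMSEQ_const_iff)
  then show "A *v (y * h) = 0"
    by simp
  let ?V = "range (\<lambda>v. A *v (y * v))"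
  \<comment> \<open>Solving \<open>eq\<close> for the quadratic term gives the preimage (-2 / t_k)
    d_k. These preimages need not converge, so the limit is taken among the images, where closedness
    of the range supplies a preimage of A(h o h).\<close>
  have "A *v (d k * d k) \<in> ?V" for k
  proof -
    have "A *v (y * ((- 2 / t k) *\<^sub>R d k)) = (- 2 / t k) *\<^sub>R (A *v (y * d k))"
      by (simp flip: matrix_vector_mult_scaleR)
    also have "\<dots> = (- 1 / t k) *\<^sub>R (2 *\<^sub>R (A *v (y * d k)))"
      by simp
    also have "2 *\<^sub>R (A *v (y * d k)) = - (t k *\<^sub>R (A *v (d k * d k)))"
      using eq[of k] by (simp add: eq_neg_iff_add_eq_0)
    also have "(- 1 / t k) *\<^sub>R \<dots> = A *v (d k * d k)"
      using t(1)[of k] by simp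
    finally show ?thesis
      by (metis rangeI)
  qed
  moreover have "closed ?V"
  proof -
    have "?V = range ((*v) (A ** diag_matrix y))"
      by (simp add: matrix_diag_mult_vec)
    then show ?thesis
      by (simp add: closed_subspace linear_subspace_image)
  qed
  moreover have "(\<lambda>k. A *v (d k * d k)) \<longlonglongrightarrow> A *v (h * h)"
    by (intro tendsto_intros d)
  ultimately show "A *v (h * h) \<in> ?V"
    using closed_sequentially[of ?V "\<lambda>k. A *v (d k * d k)"] by simp
qed

text \<open>Take the root z on the same side of 0 as x. Then |x + z| = |x| + |z| is at least |x|,
  while |x - z| |x + z| = |c|. Stating the bound as a product keeps it valid at x = 0.\<close>

lemma perturbed_sqrt:
  fixes x c :: real
  assumes "c \<le> x\<^sup>2"
  obtains z where "z\<^sup>2 = x\<^sup>2 - c" "\<bar>x - z\<bar> * \<bar>x\<bar> \<le> \<bar>c\<bar>"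
proof -
  \<comment> \<open>The sign at 0 is set to 1, so that s^2 = 1 holds there too and z still has the
    required square.\<close>
  define s where "s = (if x \<ge> 0 then 1 else - 1 :: real)"
  define z where "z = s * sqrt (x\<^sup>2 - c)"
  have s: "s\<^sup>2 = 1" "s * \<bar>x\<bar> = x" "\<bar>s\<bar> = 1"
    by (auto simp: s_def)
  have sq: "z\<^sup>2 = x\<^sup>2 - c"
    using assms by (simp add: z_def power_mult_distrib s)
  have "x + z = s * (\<bar>x\<bar> + sqrt (x\<^sup>2 - c))"
    by (simp add: z_def distrib_left s)
  then have "\<bar>x + z\<bar> = \<bar>x\<bar> + sqrt (x\<^sup>2 - c)"
    using assms by (simp add: abs_mult s)
  then have "\<bar>x\<bar> \<le> \<bar>x + z\<bar>"
    using assms by simp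
  then have "\<bar>x - z\<bar> * \<bar>x\<bar> \<le> \<bar>x - z\<bar> * \<bar>x + z\<bar>"
    by (simp add: mult_left_mono)
  also have "\<dots> = \<bar>x\<^sup>2 - z\<^sup>2\<bar>"
    by (simp add: power2_eq_square square_diff_square_factored abs_mult mult.commute)
  also have "\<dots> = \<bar>c\<bar>"
    by (simp add: sq)
  finally show ?thesis
    by (rule that[OF sq])
qed

lemma eventually_perturbed_sqrt:
  fixes a h v :: real
  shows "\<forall>\<^sub>F t in at_right 0. \<exists>z. z\<^sup>2 = (a + t * h)\<^sup>2 - t\<^sup>2 * (a * v) \<and> \<bar>a + t * h - z\<bar> \<le> 2 * \<bar>v\<bar> * t\<^sup>2"
proof (cases "a = 0")
  case True
  then show ?thesis
    \<comment> \<open>For a = 0 the correction t^2 (a v) vanishes, and z = t h is exact.\<close>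
    by (intro always_eventually allI exI[of _ "_ * h"]) auto
next
  case False
  have "((\<lambda>t. (a + t * h)\<^sup>2 - t\<^sup>2 * (a * v)) \<longlongrightarrow> (a + 0 * h)\<^sup>2 - 0\<^sup>2 * (a * v)) (at_right 0)"
    "((\<lambda>t. \<bar>a + t * h\<bar>) \<longlongrightarrow> \<bar>a + 0 * h\<bar>) (at_right 0)"
    by (intro tendsto_intros)+
  \<comment> \<open>The first limit a^2 > 0 makes the radicand positive. The second keeps |a + t h|
    above |a| / 2, and dividing t^2 |a v| by |a| / 2 produces the constant 2 |v|.\<close>
  from order_tendstoD(1)[OF this(1), of 0] order_tendstoD(1)[OF this(2), of "\<bar>a\<bar> / 2"]
  have "\<forall>\<^sub>F t in at_right 0. 0 < (a + t * h)\<^sup>2 - t\<^sup>2 * (a * v)"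
    "\<forall>\<^sub>F t in at_right 0. \<bar>a\<bar> / 2 < \<bar>a + t * h\<bar>"
    using False by simp_all
  then show ?thesis
  proof eventually_elim
    case (elim t)
    then obtain z where z: "z\<^sup>2 = (a + t * h)\<^sup>2 - t\<^sup>2 * (a * v)"
      "\<bar>a + t * h - z\<bar> * \<bar>a + t * h\<bar> \<le> \<bar>t\<^sup>2 * (a * v)\<bar>"
      using perturbed_sqrt[of "t\<^sup>2 * (a * v)" "a + t * h"] by auto
    have "\<bar>a + t * h - z\<bar> * (\<bar>a\<bar> / 2) \<le> \<bar>a + t * h - z\<bar> * \<bar>a + t * h\<bar>"
      using elim(2) by (intro mult_left_mono) auto
    also note z(2)
    also have "\<bar>t\<^sup>2 * (a * v)\<bar> = (2 * \<bar>v\<bar> * t\<^sup>2) * (\<bar>a\<bar> / 2)"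
      by (simp add: abs_mult)
    finally have "\<bar>a + t * h - z\<bar> \<le> 2 * \<bar>v\<bar> * t\<^sup>2"
      using False by simp
    with z(1) show ?case
      by blast
  qed
qed

lemma inner_tangent_squared_feasible:
  fixes A :: "real ^ 'n ^ 'm"
  assumes y: "y \<in> squared_feasible A b"
    and yh: "A *v (y * h) = 0" and hh: "A *v (h * h) = A *v (y * v)"
  shows "h \<in> inner_tangent_cone (squared_feasible A b) y"
proof (rule inner_tangent_coneI)
  \<comment> \<open>The norm is at most the sum of the absolute coordinates, so the coordinate
    constants add up. Having finitely many coordinates also lets one threshold for t serve all of
    them.\<close>
  let ?C = "\<Sum>i\<in>UNIV. 2 * \<bar>v $ i\<bar>"
  have "\<forall>\<^sub>F t in at_right 0. \<forall>i. \<exists>z. z\<^sup>2 = (y $ i + t * h $ i)\<^sup>2 - t\<^sup>2 * (y $ i * v $ i) \<and>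
      \<bar>y $ i + t * h $ i - z\<bar> \<le> 2 * \<bar>v $ i\<bar> * t\<^sup>2"
    by (intro eventually_all_finite eventually_perturbed_sqrt)
  then show "\<forall>\<^sub>F t in at_right 0. \<exists>z\<in>squared_feasible A b. norm (y + t *\<^sub>R h - z) \<le> ?C * t\<^sup>2"
  proof eventually_elim
    case (elim t)
    then obtain f where f: "\<And>i. (f i)\<^sup>2 = (y $ i + t * h $ i)\<^sup>2 - t\<^sup>2 * (y $ i * v $ i)"
      and le: "\<And>i. \<bar>y $ i + t * h $ i - f i\<bar> \<le> 2 * \<bar>v $ i\<bar> * t\<^sup>2"
      by metis
    define z where "z = (\<chi> i. f i)"
    have "z * z = y * y + (2 * t) *\<^sub>R (y * h) + t\<^sup>2 *\<^sub>R (h * h) - t\<^sup>2 *\<^sub>R (y * v)"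
      using f by (simp add: vec_eq_iff z_def power2_eq_square algebra_simps)
    then have "A *v (z * z) = A *v (y * y) + (2 * t) *\<^sub>R (A *v (y * h)) + t\<^sup>2 *\<^sub>R (A *v (h * h))
        - t\<^sup>2 *\<^sub>R (A *v (y * v))"
      by (simp only: matrix_vector_right_distrib matrix_vector_mult_diff_distrib matrix_vector_mult_scaleR)
    \<comment> \<open>The linear term vanishes by \<open>yh\<close>, and the two t^2 terms cancel by
      \<open>hh\<close>.\<close>
    then have "z \<in> squared_feasible A b"
      using y by (simp add: squared_feasible_def yh hh)
    moreover have "norm (y + t *\<^sub>R h - z) \<le> (\<Sum>i\<in>UNIV. \<bar>(y + t *\<^sub>R h - z) $ i\<bar>)"
      by (rule norm_le_l1_cart)
    then have "norm (y + t *\<^sub>R h - z) \<le> ?C * t\<^sup>2"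
      using sum_mono[of UNIV "\<lambda>i. \<bar>(y + t *\<^sub>R h - z) $ i\<bar>" "\<lambda>i. 2 * \<bar>v $ i\<bar> * t\<^sup>2"] le
      by (simp add: z_def sum_distrib_right)
    ultimately show ?case
      by blast
  qed
qed

theorem proposition2:
  fixes A :: "real ^ 'n ^ 'm" and b :: "real ^ 'm" and y :: "real ^ 'n"
    and M N :: "(real ^ 'm) list" and r :: nat
  assumes "rank A = CARD('m)"
    and "{x :: real ^ 'n. (\<forall>i. 0 \<le> x $ i) \<and> A *v x = b} \<noteq> {}"
    and "y \<in> squared_feasible A b"
    and "regular_representation A y M N r"
  shows "inner_tangent_cone (squared_feasible A b) y
           = contingent_tangent_cone (squared_feasible A b) y \<and>
         contingent_tangent_cone (squared_feasible A b) y
           = {h. rows_mult M (A *v (y * h)) = replicate r 0 \<and>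
                 rows_mult N (A *v (h * h)) = replicate (CARD('m) - r) 0}"
proof -
  let ?S = "squared_feasible A b"
  \<comment> \<open>\<open>?K\<close> is the basis-free form of the right-hand side. The inclusions
    contingent cone, \<open>?K\<close>, inner cone, contingent cone close a cycle, which gives both
    equalities at once.\<close>
  let ?K = "{h. A *v (y * h) = 0 \<and> A *v (h * h) \<in> range (\<lambda>v. A *v (y * v))}"
  have "contingent_tangent_cone ?S y \<subseteq> ?K"
    using contingent_tangent_squared_feasible[OF assms(3)] by blast
  moreover have "?K \<subseteq> inner_tangent_cone ?S y"
    using inner_tangent_squared_feasible[OF assms(3)] by blast
  moreover have "inner_tangent_cone ?S y \<subseteq> contingent_tangent_cone ?S y"
    by (rule inner_subset_contingent_tangent_cone)
  ultimately show ?thesis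
    unfolding regular_representation_kernels[OF assms(4)] by blast
qed

end
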